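(* Let $X$ be a Banach space, $E\subset X$ a nonempty closed convex subset, and $T:E\to E$ a contractive-like mapping, i.e. there exist a constant $\delta\in[0,1)$ and a strictly increasing continuous function $\varphi:[0,\infty)\to[0,\infty)$ with $\varphi(0)=0$ such that $$\|Tx-Ty\|\le \delta\|x-y\|+\varphi(\|x-Tx\|)\qquad\text{for all }x,y\in E.$$ Suppose the set of fixed points $F_T=\{p: p=Tp\}$ is nonempty and let $p\in F_T$. Let $k\ge 2$ be an integer and let $\{\alpha_n\}_{n\ge0}$ and $\{\beta_n^i\}_{n\ge0}$, $i=1,\dots,k-1$, be real sequences in $[0,1)$. Assume that there is a constant $A$ with $\alpha_n\ge A>0$ for all $n\in\mathbb{N}$. Let $\{u_n\}_{n\ge0}$ be the Mann iteration with parameters $\{\alpha_n\}$ and let $\{x_n\}_{n\ge0}$ be the new multistep iteration with parameters $k$, $\{\alpha_n\}$, $\{\beta_n^i\}$, with the same initial point $x_0=u_0\in E$. Then the following are equivalent: (1) the Mann iteration $\{u_n\}$ converges to $p$; (2) the new multistep iteration $\{x_n\}$ converges to $p$.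
   Context: $\mathbb{N}$ denotes the set of all nonnegative integers. Convergence is in the norm of $X$. The Mann iteration is defined by $u_0\in E$ and $u_{n+1}=(1-\alpha_n)u_n+\alpha_nTu_n$, $n\in\mathbb{N}$. The new multistep iteration (with $k\ge2$) is defined by $x_0\in E$ and, for $n\in\mathbb{N}$, $$x_{n+1}=(1-\alpha_n)y_n^1+\alpha_nTy_n^1,$$ $$y_n^i=(1-\beta_n^i)y_n^{i+1}+\beta_n^iTy_n^{i+1},\quad i=1,\dots,k-2,$$ $$y_n^{k-1}=(1-\beta_n^{k-1})x_n+\beta_n^{k-1}Tx_n.$$ (For $k=2$ the middle line is void.) *)

theory Defs
  imports "HOL-Analysis.Analysis"
begin

definition contractive_like_on ::
    "'a::real_normed_vector set \<Rightarrow> ('a \<Rightarrow> 'a) \<Rightarrow> bool" where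
  "contractive_like_on E T \<longleftrightarrow>
     (\<exists>(\<delta>::real) (\<phi>::real \<Rightarrow> real).
        0 \<le> \<delta> \<and> \<delta> < 1 \<and>
        \<phi> ` {0..} \<subseteq> {0..} \<and> strict_mono_on {0..} \<phi> \<and> continuous_on {0..} \<phi> \<and> \<phi> 0 = 0 \<and>
        (\<forall>x\<in>E. \<forall>y\<in>E. norm (T x - T y) \<le> \<delta> * norm (x - y) + \<phi> (norm (x - T x))))"

definition fixed_points_on :: "'a set \<Rightarrow> ('a \<Rightarrow> 'a) \<Rightarrow> 'a set" where
  "fixed_points_on E T = {p \<in> E. p = T p}"

definition mann_iteration ::
    "'a::real_vector set \<Rightarrow> ('a \<Rightarrow> 'a) \<Rightarrow> (nat \<Rightarrow> real) \<Rightarrow> (nat \<Rightarrow> 'a) \<Rightarrow> bool" where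
  "mann_iteration E T \<alpha> u \<longleftrightarrow>
     u 0 \<in> E \<and>
     (\<forall>n. u (Suc n) = (1 - \<alpha> n) *\<^sub>R u n + \<alpha> n *\<^sub>R T (u n))"

text \<open>
  The first argument of \<open>\<beta>\<close> and \<open>y\<close> is the step index written as a superscript in the
  usual notation, the second one is the sequence index.  For \<open>k \<ge> 2\<close> and given \<open>x n\<close>, the
  equations determine the intermediate points \<open>y i n\<close>, \<open>1 \<le> i \<le> k - 1\<close>, by downward recursion
  on \<open>i\<close>; for \<open>k = 2\<close> the range \<open>{1..k - 2}\<close> is empty.
\<close>

definition new_multistep_iteration ::
    "'a::real_vector set \<Rightarrow> ('a \<Rightarrow> 'a) \<Rightarrow> nat \<Rightarrow> (nat \<Rightarrow> real) \<Rightarrow> (nat \<Rightarrow> nat \<Rightarrow> real) \<Rightarrow>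
      (nat \<Rightarrow> 'a) \<Rightarrow> bool" where
  "new_multistep_iteration E T k \<alpha> \<beta> x \<longleftrightarrow>
     x 0 \<in> E \<and>
     (\<exists>y :: nat \<Rightarrow> nat \<Rightarrow> 'a. \<forall>n.
        x (Suc n) = (1 - \<alpha> n) *\<^sub>R y 1 n + \<alpha> n *\<^sub>R T (y 1 n) \<and>
        (\<forall>i\<in>{1..k - 2}. y i n = (1 - \<beta> i n) *\<^sub>R y (i + 1) n + \<beta> i n *\<^sub>R T (y (i + 1) n)) \<and>
        y (k - 1) n = (1 - \<beta> (k - 1) n) *\<^sub>R x n + \<beta> (k - 1) n *\<^sub>R T (x n))"

end

theory Submission
  imports Defs
begin

text \<open>
  The equivalence holds because both iterations always converge to \<open>p\<close>.  Putting the fixed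
  point \<open>p\<close> in the first argument of the contractive-like inequality makes the perturbation
  \<open>\<phi> (\<parallel>p - T p\<parallel>) = \<phi> 0\<close> vanish, so \<open>T\<close> contracts distances to \<open>p\<close> by the factor \<open>\<delta> < 1\<close>
  (\<open>contractive_like_on_fixed_point\<close>).  A relaxation step \<open>z \<mapsto> (1 - t) z + t T z\<close> therefore
  contracts them by \<open>1 - t (1 - \<delta>)\<close> (\<open>relaxation_step_norm_le\<close>).

  For the Mann iteration, \<open>t = \<alpha> n \<ge> A\<close> makes every step contract by at least the fixed factor
  \<open>1 - A (1 - \<delta>) < 1\<close>.  In the multistep iteration the inner steps, with \<open>t = \<beta> i n \<ge> 0\<close>, at
  least do not increase the distance to \<open>p\<close>, and the outer step contracts by the same factor as
  a Mann step.  In both cases the distance to \<open>p\<close> decays geometrically.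
\<close>

lemma contractive_like_on_fixed_point:
  assumes "contractive_like_on E T" and "p \<in> fixed_points_on E T"
  obtains \<delta> where "0 \<le> \<delta>" "\<delta> < 1" "\<And>z. z \<in> E \<Longrightarrow> norm (T z - p) \<le> \<delta> * norm (z - p)"
proof -
  from assms(1) obtain \<delta> :: real and \<phi> :: "real \<Rightarrow> real"
    where \<delta>: "0 \<le> \<delta>" "\<delta> < 1" and "\<phi> 0 = 0"
      and le: "\<forall>x\<in>E. \<forall>y\<in>E. norm (T x - T y) \<le> \<delta> * norm (x - y) + \<phi> (norm (x - T x))"
    unfolding contractive_like_on_def by blast
  from assms(2) have "p \<in> E" and Tp: "T p = p"
    by (auto simp: fixed_points_on_def)
  have "norm (T z - p) \<le> \<delta> * norm (z - p)" if "z \<in> E" for z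
    using le[rule_format, OF \<open>p \<in> E\<close> that] Tp \<open>\<phi> 0 = 0\<close> by (simp add: norm_minus_commute)
  with \<delta> that show thesis by blast
qed

lemma relaxation_step_in_convex:
  fixes T :: "'a::real_vector \<Rightarrow> 'a"
  assumes "convex E" and "T \<in> E \<rightarrow> E" and "z \<in> E" and "0 \<le> t" and "t \<le> 1"
  shows "(1 - t) *\<^sub>R z + t *\<^sub>R T z \<in> E"
  using assms by (auto intro!: convexD)

lemma relaxation_step_norm_le:
  fixes T :: "'a::real_normed_vector \<Rightarrow> 'a"
  assumes Tz: "norm (T z - p) \<le> \<delta> * norm (z - p)" and "0 \<le> t" and "t \<le> 1"
  shows "norm ((1 - t) *\<^sub>R z + t *\<^sub>R T z - p) \<le> (1 - t * (1 - \<delta>)) * norm (z - p)"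
proof -
  have "(1 - t) *\<^sub>R z + t *\<^sub>R T z - p = (1 - t) *\<^sub>R (z - p) + t *\<^sub>R (T z - p)"
    by (simp add: algebra_simps)
  also have "norm \<dots> \<le> (1 - t) * norm (z - p) + t * norm (T z - p)"
    using norm_triangle_ineq[of "(1 - t) *\<^sub>R (z - p)" "t *\<^sub>R (T z - p)"] assms(2,3) by simp
  also have "\<dots> \<le> (1 - t) * norm (z - p) + t * (\<delta> * norm (z - p))"
    using mult_left_mono[OF Tz \<open>0 \<le> t\<close>] by simp
  also have "\<dots> = (1 - t * (1 - \<delta>)) * norm (z - p)"
    by (simp add: algebra_simps)
  finally show ?thesis .
qed

lemma geometric_decay_tendsto:
  fixes a :: "nat \<Rightarrow> 'a::real_normed_vector"
  assumes "0 \<le> q" and "q < 1" and step: "\<And>n. norm (a (Suc n) - p) \<le> q * norm (a n - p)"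
  shows "a \<longlonglongrightarrow> p"
proof -
  have le: "norm (a n - p) \<le> q ^ n * norm (a 0 - p)" for n
  proof (induction n)
    case (Suc n)
    have "norm (a (Suc n) - p) \<le> q * (q ^ n * norm (a 0 - p))"
      using step[of n] mult_left_mono[OF Suc \<open>0 \<le> q\<close>] by linarith
    then show ?case by (simp add: mult.assoc)
  qed simp
  have "(\<lambda>n. q ^ n * norm (a 0 - p)) \<longlonglongrightarrow> 0"
    using LIMSEQ_power_zero[of q] assms(1,2) by (intro tendsto_mult_left_zero) simp
  then have "(\<lambda>n. a n - p) \<longlonglongrightarrow> 0"
    by (rule tendsto_0_le[where K = 1]) (use le assms(1) in \<open>simp add: always_eventually\<close>)
  then show ?thesis by (simp add: LIM_zero_iff)
qed

text \<open>
  The common form of both iterations: a relaxation step applied not to the current iterate but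
  to some point \<open>w n\<close> of \<open>E\<close> that is no farther from \<open>p\<close>.  The Mann iteration is the case
  \<open>w = a\<close>; the multistep iteration takes for \<open>w n\<close> the inner point computed last.
\<close>

lemma predicted_relaxation_tendsto:
  fixes T :: "'a::real_normed_vector \<Rightarrow> 'a"
  assumes "convex E" and "T \<in> E \<rightarrow> E"
    and "\<delta> < 1" and "0 \<le> \<delta>" and contr: "\<And>z. z \<in> E \<Longrightarrow> norm (T z - p) \<le> \<delta> * norm (z - p)"
    and "0 < A" and \<alpha>: "\<And>n. A \<le> \<alpha> n" "\<And>n. \<alpha> n \<le> 1"
    and "a 0 \<in> E"
    and step: "\<And>n. a (Suc n) = (1 - \<alpha> n) *\<^sub>R w n + \<alpha> n *\<^sub>R T (w n)"
    and w: "\<And>n. a n \<in> E \<Longrightarrow> w n \<in> E \<and> norm (w n - p) \<le> norm (a n - p)"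
  shows "a \<longlonglongrightarrow> p"
proof (rule geometric_decay_tendsto)
  have \<alpha>0: "0 \<le> \<alpha> n" for n
    using \<open>0 < A\<close> \<alpha>(1)[of n] by linarith
  have a_in: "a n \<in> E" for n
  proof (induction n)
    case (Suc n)
    then show ?case
      using relaxation_step_in_convex[OF assms(1,2)] w \<alpha>0 \<alpha>(2) by (simp add: step)
  qed (fact \<open>a 0 \<in> E\<close>)
  have "A \<le> 1"
    using \<alpha>[of 0] by linarith
  then have "A * (1 - \<delta>) \<le> 1 * 1"
    using assms by (intro mult_mono) auto
  then show q0: "0 \<le> 1 - A * (1 - \<delta>)"
    by simp
  show "1 - A * (1 - \<delta>) < 1"
    using \<open>0 < A\<close> \<open>\<delta> < 1\<close> by simp
  fix n
  have "norm (a (Suc n) - p) \<le> (1 - \<alpha> n * (1 - \<delta>)) * norm (w n - p)"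
    unfolding step using a_in w contr \<alpha>0 \<alpha>(2) by (intro relaxation_step_norm_le) auto
  also have "\<dots> \<le> (1 - A * (1 - \<delta>)) * norm (w n - p)"
    using \<alpha>(1) \<open>\<delta> < 1\<close> by (intro mult_right_mono) (auto intro: mult_right_mono)
  also have "\<dots> \<le> (1 - A * (1 - \<delta>)) * norm (a n - p)"
    using w[OF a_in] q0 by (intro mult_left_mono) auto
  finally show "norm (a (Suc n) - p) \<le> (1 - A * (1 - \<delta>)) * norm (a n - p)" .
qed

text \<open>
  The inner points \<open>z 1, \<dots>, z m\<close> of a single outer step are computed from \<open>x\<close> downwards,
  starting with \<open>z m\<close>.  No lower bound on the weights \<open>b i\<close> is available, so each inner step is
  merely nonexpansive towards \<open>p\<close>.
\<close>

lemma inner_steps_nonexpansive: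
  fixes T :: "'a::real_normed_vector \<Rightarrow> 'a" and m :: nat
  assumes "convex E" and "T \<in> E \<rightarrow> E"
    and "\<delta> < 1" and contr: "\<And>v. v \<in> E \<Longrightarrow> norm (T v - p) \<le> \<delta> * norm (v - p)"
    and b: "\<And>i. i \<in> {1..m} \<Longrightarrow> b i \<in> {0..1}"
    and start: "z m = (1 - b m) *\<^sub>R x + b m *\<^sub>R T x" and "x \<in> E"
    and step: "\<And>i. i \<in> {1..<m} \<Longrightarrow> z i = (1 - b i) *\<^sub>R z (i + 1) + b i *\<^sub>R T (z (i + 1))"
    and i: "1 \<le> i" "i \<le> m"
  shows "z i \<in> E \<and> norm (z i - p) \<le> norm (x - p)"
proof -
  have one: "(1 - t) *\<^sub>R v + t *\<^sub>R T v \<in> E \<and>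
      norm ((1 - t) *\<^sub>R v + t *\<^sub>R T v - p) \<le> norm (v - p)"
    if "v \<in> E" "t \<in> {0..1}" for t v
  proof -
    have "(1 - t * (1 - \<delta>)) * norm (v - p) \<le> 1 * norm (v - p)"
      using that \<open>\<delta> < 1\<close> by (intro mult_right_mono) auto
    then show ?thesis
      using relaxation_step_in_convex[OF assms(1,2)]
        relaxation_step_norm_le[of T v p \<delta> t] contr that by fastforce
  qed
  from i(2) show ?thesis
  proof (induction rule: inc_induct)
    case base
    show ?case using one[OF \<open>x \<in> E\<close> b[of m]] i by (simp add: start)
  next
    case (step j)
    with i(1) have IH: "z (j + 1) \<in> E" "norm (z (j + 1) - p) \<le> norm (x - p)" and "b j \<in> {0..1}"
      using b[of j] by auto
    moreover have "z j = (1 - b j) *\<^sub>R z (j + 1) + b j *\<^sub>R T (z (j + 1))"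
      using step i(1) assms(8) by auto
    ultimately show ?case
      using one[of "z (j + 1)" "b j"] by (metis order_trans)
  qed
qed

theorem theorem1:
  fixes E :: "'a::banach set" and T :: "'a \<Rightarrow> 'a" and p :: 'a
    and k :: nat and \<alpha> :: "nat \<Rightarrow> real" and \<beta> :: "nat \<Rightarrow> nat \<Rightarrow> real" and A :: real
    and u x :: "nat \<Rightarrow> 'a"
  assumes "E \<noteq> {}" and "closed E" and "convex E"
    and "T \<in> E \<rightarrow> E" and "contractive_like_on E T"
    and "fixed_points_on E T \<noteq> {}" and "p \<in> fixed_points_on E T"
    and "k \<ge> 2"
    and "\<And>n. \<alpha> n \<in> {0..<1}"
    and "\<And>i n. i \<in> {1..k - 1} \<Longrightarrow> \<beta> i n \<in> {0..<1}"
    and "A > 0" and "\<And>n. \<alpha> n \<ge> A"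
    and "mann_iteration E T \<alpha> u"
    and "new_multistep_iteration E T k \<alpha> \<beta> x"
    and "x 0 = u 0"
  shows "u \<longlonglongrightarrow> p \<longleftrightarrow> x \<longlonglongrightarrow> p"
proof -
  obtain \<delta> where \<delta>: "0 \<le> \<delta>" "\<delta> < 1"
    and contr: "\<And>z. z \<in> E \<Longrightarrow> norm (T z - p) \<le> \<delta> * norm (z - p)"
    using contractive_like_on_fixed_point[OF assms(5,7)] by blast
  have \<alpha>1: "\<alpha> n \<le> 1" for n
    using assms(9)[of n] by simp
  note tendsto = predicted_relaxation_tendsto
    [OF \<open>convex E\<close> \<open>T \<in> E \<rightarrow> E\<close> \<delta>(2,1) contr \<open>A > 0\<close> assms(12) \<alpha>1]
  have "u \<longlonglongrightarrow> p"
    using assms(13) unfolding mann_iteration_def by (intro tendsto[where w = u]) auto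
  moreover have "x \<longlonglongrightarrow> p"
  proof -
    from assms(14) obtain y where "x 0 \<in> E"
      and outer: "\<And>n. x (Suc n) = (1 - \<alpha> n) *\<^sub>R y 1 n + \<alpha> n *\<^sub>R T (y 1 n)"
      and inner: "\<And>n i. i \<in> {1..k - 2} \<Longrightarrow>
        y i n = (1 - \<beta> i n) *\<^sub>R y (i + 1) n + \<beta> i n *\<^sub>R T (y (i + 1) n)"
      and start: "\<And>n. y (k - 1) n = (1 - \<beta> (k - 1) n) *\<^sub>R x n + \<beta> (k - 1) n *\<^sub>R T (x n)"
      unfolding new_multistep_iteration_def by blast
    have \<beta>: "\<beta> i n \<in> {0..1}" if "i \<in> {1..k - 1}" for i n
      using assms(10)[OF that, of n] by simp
    have "{1..<k - 1} = {1..k - 2}"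
      by auto
    with inner have inner': "y i n = (1 - \<beta> i n) *\<^sub>R y (i + 1) n + \<beta> i n *\<^sub>R T (y (i + 1) n)"
      if "i \<in> {1..<k - 1}" for i n
      using that by blast
    have "y 1 n \<in> E \<and> norm (y 1 n - p) \<le> norm (x n - p)" if "x n \<in> E" for n
      using \<open>k \<ge> 2\<close>
      by (intro inner_steps_nonexpansive[where z = "\<lambda>i. y i n" and b = "\<lambda>i. \<beta> i n",
          OF \<open>convex E\<close> \<open>T \<in> E \<rightarrow> E\<close> \<delta>(2) contr \<beta> start that inner']) auto
    with \<open>x 0 \<in> E\<close> outer show ?thesis
      by (intro tendsto[where w = "y 1"])
  qed
  ultimately show ?thesis
    by blast
qed

end
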